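(* Let $G^{C_4}$ be a $4$-base-module with $C_4=v_1v_2v_3v_4v_1$, let $f$ be a module-colouring of $G^{C_4}$ with $f(v_1)=f(v_3)=1$, $f(v_2)=f(v_4)=2$ and $P_{2i}^f(v_2,v_4)\neq\emptyset$ for $i=3,4$, and let $W_4=u$-$u_1u_2u_3u_2'u_1$ be a contractible $4$-wheel with respect to $f$. Let $H^{C_4}$ be obtained from $G^{C_4}$ by the contracting $4$-wheel operation on $W_4$ with contracted vertices $u_2,u_2'$ (the merged vertex keeping the name of a vertex of $C_4$ if one of $u_2,u_2'$ lies on $C_4$). If $H^{C_4}$ is decyclizable, i.e. has a proper $4$-colouring $f'$ with $f'(v_2)\neq f'(v_4)$, then $G^{C_4}$ is decyclizable, i.e. there is a proper $4$-colouring $f^*$ of $G^{C_4}$ with $f^*(v_2)\neq f^*(v_4)$.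
   Context: A semi-maximal planar graph (SMPG) $G^C$ is a plane graph whose outer face is bounded by the cycle $C$ (length $\ge4$) and all other faces are triangles. Colours are $\{1,2,3,4\}$; $C_4^0(\cdot)$ denotes proper $4$-colourings up to permutation of colour names; $f(H)=\{f(v):v\in V(H)\}$; a bichromatic cycle of $f$ is a cycle $C$ with $|f(C)|=2$. If $f(C)=\{i,j\}$ and $\{s,t\}$ are the other colours, $\sigma(f,C)$ interchanges $s,t$ on all vertices in the interior of $C$; Kempe-equivalence is generated by $\sigma$-operations and $F^f(\cdot)$ is the Kempe class of $f$. For a $4$-chromatic maximal planar graph $G$ with $\delta(G)\ge4$, a bichromatic cycle $C$ of $f$ is a UB-cycle if $|f'(C)|=2$ for all $f'\in F^f(G)$, and $f$ is then a UBC-colouring with respect to $C$. An SMPG $G^C$ with $|C|=4$ is a $4$-base-module if there is an SMPG $G_1^C$ with $G^C\cap G_1^C=C$ (in the exterior of $C$) such that $G=G^C\cup G_1^C$ is a $4$-chromatic maximal planar graph with $\delta(G)\ge4$ having a UBC-colouring with respect to $C$; a module-colouring of $G^C$ is the restriction to $G^C$ of such a UBC-colouring. $P_{2i}^f(v_2,v_4)$ is the set of paths from $v_2$ to $v_4$ all of whose vertices have colours in $\{2,i\}$ under $f$. A $4$-wheel $W_4=u$-$u_1u_2u_3u_2'u_1$ consists of a vertex $u$ (not on $C_4$) of degree $4$ with neighbours $u_1,u_2,u_3,u_2'$ in cyclic order; it is contractible with respect to $f$ if $|\{u_2,u_2'\}\cap V(C_4)|\le1$ and $f(u_2)=f(u_2')$.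 The contracting $4$-wheel operation deletes $u$, identifies $u_2$ and $u_2'$ into one vertex adjacent to all former neighbours of both, and merges parallel edges. *)

theory Defs
  imports "HOL-Analysis.Analysis" "HOL-Combinatorics.Transposition"
begin

section \<open>Abstract simple graphs\<close>

record 'a graph =
  verts :: "'a set"
  edges :: "'a set set"

definition degree :: "'a graph \<Rightarrow> 'a \<Rightarrow> nat" where
  "degree g v = card {w. {v, w} \<in> edges g}"

definition min_degree :: "'a graph \<Rightarrow> nat" where
  "min_degree g = Min (degree g ` verts g)"

text \<open>Colourings are total functions of which only the values on the vertices matter.\<close>

definition proper_colouring :: "nat \<Rightarrow> 'a graph \<Rightarrow> ('a \<Rightarrow> nat) \<Rightarrow> bool" where
  "proper_colouring k g f \<longleftrightarrow>
     f ` verts g \<subseteq> {1..k} \<and> (\<forall>x y. {x, y} \<in> edges g \<longrightarrow> f x \<noteq> f y)"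

definition chromatic_number :: "'a graph \<Rightarrow> nat" where
  "chromatic_number g = (LEAST k. \<exists>f. proper_colouring k g f)"

definition is_path :: "'a graph \<Rightarrow> 'a \<Rightarrow> 'a \<Rightarrow> 'a list \<Rightarrow> bool" where
  "is_path g x y p \<longleftrightarrow>
     p \<noteq> [] \<and> hd p = x \<and> last p = y \<and> distinct p \<and> set p \<subseteq> verts g \<and>
     (\<forall>i. Suc i < length p \<longrightarrow> {p ! i, p ! Suc i} \<in> edges g)"

definition bicoloured_paths ::
    "'a graph \<Rightarrow> ('a \<Rightarrow> nat) \<Rightarrow> nat \<Rightarrow> nat \<Rightarrow> 'a \<Rightarrow> 'a \<Rightarrow> 'a list set" where
  "bicoloured_paths g f c d x y = {p. is_path g x y p \<and> f ` set p \<subseteq> {c, d}}"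

definition decyclizable :: "'a graph \<Rightarrow> 'a \<Rightarrow> 'a \<Rightarrow> bool" where
  "decyclizable g x y \<longleftrightarrow> (\<exists>f. proper_colouring 4 g f \<and> f x \<noteq> f y)"

text \<open>Delete \<open>u\<close> and identify \<open>a\<close> and \<open>b\<close> into a vertex named \<open>w\<close>. Parallel edges merge because
  the edges form a set. No loop arises as long as \<open>a\<close> and \<open>b\<close> are not adjacent, in particular when
  they have the same colour in a proper colouring.\<close>

definition contract_wheel :: "'a graph \<Rightarrow> 'a \<Rightarrow> 'a \<Rightarrow> 'a \<Rightarrow> 'a \<Rightarrow> 'a graph" where
  "contract_wheel g u a b w =
     (let \<phi> = (\<lambda>x. if x \<in> {a, b} then w else x)
      in \<lparr>verts = \<phi> ` (verts g - {u}), edges = (`) \<phi> ` {e \<in> edges g. u \<notin> e}\<rparr>)"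

section \<open>Plane graphs\<close>

text \<open>Vertices are points of the plane and an edge is the point set of an arc joining its ends. The
  ends of an edge are recovered as the vertices lying on it.\<close>

record drawing =
  points :: "complex set"
  arcs :: "complex set set"

definition joins :: "complex set \<Rightarrow> complex \<Rightarrow> complex \<Rightarrow> bool" where
  "joins e x y \<longleftrightarrow> (\<exists>g. arc g \<and> path_image g = e \<and> pathstart g = x \<and> pathfinish g = y)"

definition plane_graph :: "drawing \<Rightarrow> bool" where
  "plane_graph G \<longleftrightarrow>
     finite (points G) \<and> finite (arcs G) \<and>
     (\<forall>e\<in>arcs G. \<exists>x y. joins e x y \<and> e \<inter> points G = {x, y}) \<and>
     (\<forall>e\<in>arcs G. \<forall>e'\<in>arcs G. e \<noteq> e' \<longrightarrow>
        e \<inter> points G \<noteq> e' \<inter> points G \<and> e \<inter> e' \<subseteq> points G)"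

definition graph_of :: "drawing \<Rightarrow> complex graph" where
  "graph_of G = \<lparr>verts = points G, edges = (\<lambda>e. e \<inter> points G) ` arcs G\<rparr>"

definition support :: "drawing \<Rightarrow> complex set" where
  "support G = points G \<union> \<Union>(arcs G)"

definition faces :: "drawing \<Rightarrow> complex set set" where
  "faces G = components (- support G)"

definition outer_face :: "drawing \<Rightarrow> complex set" where
  "outer_face G = outside (support G)"

definition subdrawing :: "drawing \<Rightarrow> drawing \<Rightarrow> bool" where
  "subdrawing A G \<longleftrightarrow> points A \<subseteq> points G \<and> arcs A \<subseteq> arcs G"

definition union_drawing :: "drawing \<Rightarrow> drawing \<Rightarrow> drawing" where
  "union_drawing A B = \<lparr>points = points A \<union> points B, arcs = arcs A \<union> arcs B\<rparr>"

definition inter_drawing :: "drawing \<Rightarrow> drawing \<Rightarrow> drawing" where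
  "inter_drawing A B = \<lparr>points = points A \<inter> points B, arcs = arcs A \<inter> arcs B\<rparr>"

definition cycle_on :: "complex list \<Rightarrow> drawing \<Rightarrow> bool" where
  "cycle_on vs C \<longleftrightarrow>
     plane_graph C \<and> distinct vs \<and> 3 \<le> length vs \<and> points C = set vs \<and>
     edges (graph_of C) = {{vs ! i, vs ! (Suc i mod length vs)} | i. i < length vs}"

definition cycle_in :: "drawing \<Rightarrow> drawing \<Rightarrow> bool" where
  "cycle_in G C \<longleftrightarrow> subdrawing C G \<and> (\<exists>vs. cycle_on vs C)"

definition bounded_by :: "drawing \<Rightarrow> complex set \<Rightarrow> drawing \<Rightarrow> bool" where
  "bounded_by G F C \<longleftrightarrow> F \<in> faces G \<and> cycle_in G C \<and> frontier F = support C"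

definition triangular_face :: "drawing \<Rightarrow> complex set \<Rightarrow> bool" where
  "triangular_face G F \<longleftrightarrow> (\<exists>T. bounded_by G F T \<and> card (points T) = 3)"

definition planar :: "'a graph \<Rightarrow> bool" where
  "planar g \<longleftrightarrow>
     (\<exists>P \<phi>. plane_graph P \<and> bij_betw \<phi> (verts g) (points P) \<and>
            edges (graph_of P) = (`) \<phi> ` edges g)"

definition maximal_planar :: "'a graph \<Rightarrow> bool" where
  "maximal_planar g \<longleftrightarrow> planar g \<and>
     (\<forall>x\<in>verts g. \<forall>y\<in>verts g. x \<noteq> y \<and> {x, y} \<notin> edges g \<longrightarrow>
        \<not> planar (g\<lparr>edges := insert {x, y} (edges g)\<rparr>))"

section \<open>Semi-maximal planar graphs\<close>

text \<open>The distinguished face is a parameter: it is the unbounded face for a semi-maximal planar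
  graph drawn as usual, and the interior of \<open>C\<close> when the drawing is turned inside out, so as to lie
  in the exterior of \<open>C\<close>.\<close>

definition semi_maximal_at :: "complex set \<Rightarrow> drawing \<Rightarrow> drawing \<Rightarrow> bool" where
  "semi_maximal_at F G C \<longleftrightarrow>
     plane_graph G \<and> bounded_by G F C \<and> 4 \<le> card (points C) \<and>
     (\<forall>F'\<in>faces G - {F}. triangular_face G F')"

definition smpg :: "drawing \<Rightarrow> drawing \<Rightarrow> bool" where
  "smpg G C \<longleftrightarrow> semi_maximal_at (outer_face G) G C"

definition exterior_smpg :: "drawing \<Rightarrow> drawing \<Rightarrow> bool" where
  "exterior_smpg G C \<longleftrightarrow> semi_maximal_at (inside (support C)) G C"

section \<open>Kempe classes and unchanged bichromatic cycles\<close>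

definition bichromatic_cycle :: "drawing \<Rightarrow> (complex \<Rightarrow> nat) \<Rightarrow> drawing \<Rightarrow> bool" where
  "bichromatic_cycle G f C \<longleftrightarrow> cycle_in G C \<and> card (f ` points C) = 2"

definition swap_inside ::
    "drawing \<Rightarrow> drawing \<Rightarrow> nat \<Rightarrow> nat \<Rightarrow> (complex \<Rightarrow> nat) \<Rightarrow> complex \<Rightarrow> nat" where
  "swap_inside G C s t f =
     (\<lambda>v. if v \<in> points G \<inter> inside (support C) then Transposition.transpose s t (f v) else f v)"

definition sigma_step :: "drawing \<Rightarrow> (complex \<Rightarrow> nat) \<Rightarrow> (complex \<Rightarrow> nat) \<Rightarrow> bool" where
  "sigma_step G f f' \<longleftrightarrow> proper_colouring 4 (graph_of G) f \<and>
     (\<exists>C s t. bichromatic_cycle G f C \<and> s \<noteq> t \<and> {1..4} - f ` points C = {s, t} \<and>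
              f' = swap_inside G C s t f)"

definition rename_step :: "drawing \<Rightarrow> (complex \<Rightarrow> nat) \<Rightarrow> (complex \<Rightarrow> nat) \<Rightarrow> bool" where
  "rename_step G f f' \<longleftrightarrow> proper_colouring 4 (graph_of G) f \<and>
     (\<exists>\<pi>. bij_betw \<pi> {1..4} {1..4} \<and> f' = \<pi> \<circ> f)"

text \<open>Colourings count only up to permutation of the colour names. Instead of forming the
  quotient, renamings are admitted as steps, so that the Kempe class is a union of renaming
  classes.\<close>

definition kempe_class :: "drawing \<Rightarrow> (complex \<Rightarrow> nat) \<Rightarrow> (complex \<Rightarrow> nat) set" where
  "kempe_class G f = {f'. equivclp (\<lambda>g h. sigma_step G g h \<or> rename_step G g h) f f'}"

definition ub_cycle :: "drawing \<Rightarrow> (complex \<Rightarrow> nat) \<Rightarrow> drawing \<Rightarrow> bool" where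
  "ub_cycle G f C \<longleftrightarrow>
     bichromatic_cycle G f C \<and> (\<forall>f'\<in>kempe_class G f. card (f' ` points C) = 2)"

definition ubc_colouring :: "drawing \<Rightarrow> drawing \<Rightarrow> (complex \<Rightarrow> nat) \<Rightarrow> bool" where
  "ubc_colouring G C f \<longleftrightarrow>
     plane_graph G \<and> maximal_planar (graph_of G) \<and> chromatic_number (graph_of G) = 4 \<and>
     4 \<le> min_degree (graph_of G) \<and>
     proper_colouring 4 (graph_of G) f \<and> ub_cycle G f C"

section \<open>4-base-modules and contractible 4-wheels\<close>

definition module_extension ::
    "drawing \<Rightarrow> drawing \<Rightarrow> drawing \<Rightarrow> (complex \<Rightarrow> nat) \<Rightarrow> bool" where
  "module_extension G C G1 f \<longleftrightarrow>
     exterior_smpg G1 C \<and> inter_drawing G G1 = C \<and> ubc_colouring (union_drawing G G1) C f"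

definition four_base_module :: "drawing \<Rightarrow> drawing \<Rightarrow> bool" where
  "four_base_module G C \<longleftrightarrow>
     smpg G C \<and> card (points C) = 4 \<and> (\<exists>G1 f. module_extension G C G1 f)"

definition module_colouring :: "drawing \<Rightarrow> drawing \<Rightarrow> (complex \<Rightarrow> nat) \<Rightarrow> bool" where
  "module_colouring G C f \<longleftrightarrow>
     (\<exists>G1 g. module_extension G C G1 g \<and> (\<forall>v\<in>points G. f v = g v))"

text \<open>\<open>xs\<close> lists the neighbours of \<open>u\<close> in cyclic order: some Jordan curve around \<open>u\<close> crosses each
  edge at \<open>u\<close> exactly once, in the order of \<open>xs\<close>. The orientation and the starting point are
  immaterial.\<close>

definition cyclic_neighbours :: "drawing \<Rightarrow> complex \<Rightarrow> complex list \<Rightarrow> bool" where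
  "cyclic_neighbours G u xs \<longleftrightarrow>
     distinct xs \<and> set xs = {x. {u, x} \<in> edges (graph_of G)} \<and>
     (\<exists>J ts. simple_path J \<and> pathfinish J = pathstart J \<and> u \<in> inside (path_image J) \<and>
        length ts = length xs \<and> sorted_wrt (<) ts \<and> set ts \<subseteq> {0..<1} \<and>
        path_image J \<inter> \<Union>{e \<in> arcs G. u \<in> e} = J ` set ts \<and>
        (\<forall>i<length xs. \<exists>e\<in>arcs G. e \<inter> points G = {u, xs ! i} \<and> J (ts ! i) \<in> e))"

definition four_wheel ::
    "drawing \<Rightarrow> drawing \<Rightarrow> complex \<Rightarrow> complex \<Rightarrow> complex \<Rightarrow> complex \<Rightarrow> complex \<Rightarrow> bool" where
  "four_wheel G C u u1 u2 u3 u2' \<longleftrightarrow>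
     u \<in> points G - points C \<and> degree (graph_of G) u = 4 \<and>
     cyclic_neighbours G u [u1, u2, u3, u2']"

definition contractible_wheel ::
    "drawing \<Rightarrow> drawing \<Rightarrow> (complex \<Rightarrow> nat) \<Rightarrow>
     complex \<Rightarrow> complex \<Rightarrow> complex \<Rightarrow> complex \<Rightarrow> complex \<Rightarrow> bool" where
  "contractible_wheel G C f u u1 u2 u3 u2' \<longleftrightarrow>
     four_wheel G C u u1 u2 u3 u2' \<and> card ({u2, u2'} \<inter> points C) \<le> 1 \<and> f u2 = f u2'"

end

theory Submission
  imports Defs
begin

text \<open>A colouring of the contracted graph pulls back along the identification to a colouring of the
  graph without the hub \<open>u\<close>. It gives \<open>u2\<close> and \<open>u2'\<close> the same colour, so the four neighbours of \<open>u\<close>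
  use at most three colours and the fourth one is free for \<open>u\<close>. As \<open>u\<close> does not lie on the boundary
  cycle and the identification fixes its vertices, the colours of \<open>v2\<close> and \<open>v4\<close> are kept.\<close>

text \<open>An edge is the image of an arc, and an arc has distinct endpoints, whereas a loop would
  force both ends to be \<open>x\<close>.\<close>

lemma plane_graph_no_loops:
  assumes "plane_graph G"
  shows "{x} \<notin> edges (graph_of G)"
proof
  assume "{x} \<in> edges (graph_of G)"
  then obtain e where e: "e \<in> arcs G" "e \<inter> points G = {x}"
    by (auto simp: graph_of_def)
  have "\<forall>e\<in>arcs G. \<exists>y z. joins e y z \<and> e \<inter> points G = {y, z}"
    using assms by (simp add: plane_graph_def)
  then obtain y z where yz: "joins e y z" "e \<inter> points G = {y, z}"
    using e(1) by meson
  then have "{y, z} = {x}"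
    using e(2) by simp
  then have "y = x" "z = x"
    by simp_all
  with yz(1) have "joins e x x"
    by simp
  then show False
    by (auto simp: joins_def dest: arc_distinct_ends)
qed

text \<open>The old value \<open>h u\<close> is arbitrary and gets overwritten;
  \<open>no_loop\<close> ensures that the update at \<open>u\<close> leaves the colours of its
  neighbours alone.\<close>

lemma extend_colouring_to_degree_four_vertex:
  assumes no_loop: "{u} \<notin> edges g"
    and nbrs: "{x. {u, x} \<in> edges g} \<subseteq> {a, b, c, d}"
    and same: "h b = h d"
    and range: "h ` (verts g - {u}) \<subseteq> {1..4}"
    and proper: "\<And>x y. {x, y} \<in> edges g \<Longrightarrow> u \<notin> {x, y} \<Longrightarrow> h x \<noteq> h y"
  obtains k where "proper_colouring 4 g (h(u := k))"
proof -
  \<comment> \<open>Writing the colours as a list bounds their number without cases on which of them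
    coincide.\<close>
  have "card (set [h a, h b, h c]) \<le> 3"
    using card_length[of "[h a, h b, h c]"] by simp
  then have "\<not> {1..4::nat} \<subseteq> {h a, h b, h c}"
    using card_mono[of "{h a, h b, h c}" "{1..4::nat}"] by auto
  then obtain k where k: "k \<in> {1..4}" "k \<notin> {h a, h b, h c}"
    by blast
  \<comment> \<open>The neighbour \<open>d\<close> is covered because
    \<open>h d = h b\<close>.\<close>
  have nbr: "h x \<noteq> k" if "{u, x} \<in> edges g" for x
    using that nbrs same k(2) by auto
  have "(h(u := k)) x \<noteq> (h(u := k)) y" if e: "{x, y} \<in> edges g" for x y
  proof (cases "u \<in> {x, y}")
    case True
    then consider "x = u" | "y = u"
      by blast
    then show ?thesis
    proof cases
      case 1
      then have "y \<noteq> u" "h y \<noteq> k"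
        using e no_loop nbr[of y] by auto
      then show ?thesis
        using 1 by simp
    next
      case 2
      have "{u, x} \<in> edges g"
        using e 2 by (simp add: insert_commute)
      then have "x \<noteq> u" "h x \<noteq> k"
        using no_loop nbr[of x] by auto
      then show ?thesis
        using 2 by simp
    qed
  next
    case False
    then show ?thesis
      using proper[OF e] by auto
  qed
  moreover have "(h(u := k)) ` verts g \<subseteq> {1..4}"
    using range k(1) by auto
  ultimately have "proper_colouring 4 g (h(u := k))"
    by (simp add: proper_colouring_def)
  then show thesis
    by (rule that)
qed

text \<open>The last assumption makes the identification fix \<open>x\<close> and \<open>y\<close>:
  if one of them is merged, the merged vertex bears its name.\<close>

lemma decyclizable_contract_wheelD:
  assumes "decyclizable (contract_wheel g u b d w) x y"
    and "{u} \<notin> edges g"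
    and "{x. {u, x} \<in> edges g} \<subseteq> {a, b, c, d}"
    and "u \<notin> {x, y}"
    and "{b, d} \<inter> {x, y} \<subseteq> {w}"
  shows "decyclizable g x y"
proof -
  define \<phi> where "\<phi> = (\<lambda>x. if x \<in> {b, d} then w else x)"
  obtain f' where f': "proper_colouring 4 (contract_wheel g u b d w) f'" "f' x \<noteq> f' y"
    using assms(1) by (auto simp: decyclizable_def)
  have H: "contract_wheel g u b d w =
      \<lparr>verts = \<phi> ` (verts g - {u}), edges = (`) \<phi> ` {e \<in> edges g. u \<notin> e}\<rparr>"
    by (simp add: contract_wheel_def \<phi>_def)
  have range: "(f' \<circ> \<phi>) ` (verts g - {u}) \<subseteq> {1..4}"
    using f'(1) by (auto simp: proper_colouring_def H)
  have proper: "(f' \<circ> \<phi>) p \<noteq> (f' \<circ> \<phi>) q" if "{p, q} \<in> edges g" "u \<notin> {p, q}" for p q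
  proof -
    \<comment> \<open>This also covers an edge joining \<open>b\<close> and \<open>d\<close>: its
      image would be the loop \<open>{w}\<close>, which no proper colouring \<open>f'\<close>
      admits.\<close>
    have "\<phi> ` {p, q} \<in> edges (contract_wheel g u b d w)"
      unfolding H using that by (auto simp del: image_insert)
    then show ?thesis
      using f'(1) by (simp add: proper_colouring_def)
  qed
  have "(f' \<circ> \<phi>) b = (f' \<circ> \<phi>) d"
    by (simp add: \<phi>_def)
  then obtain k where "proper_colouring 4 g ((f' \<circ> \<phi>)(u := k))"
    using extend_colouring_to_degree_four_vertex[OF assms(2,3) _ range proper] by blast
  moreover have "\<phi> x = x" "\<phi> y = y"
    using assms(5) by (auto simp: \<phi>_def)
  then have "((f' \<circ> \<phi>)(u := k)) x \<noteq> ((f' \<circ> \<phi>)(u := k)) y"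
    using f'(2) assms(4) by auto
  ultimately show ?thesis
    unfolding decyclizable_def by blast
qed

theorem theorem5:
  fixes G C :: drawing and f :: "complex \<Rightarrow> nat"
    and v1 v2 v3 v4 u u1 u2 u3 u2' w :: complex
    and H :: "complex graph"
  assumes "four_base_module G C"
    and "cycle_on [v1, v2, v3, v4] C"
    and "module_colouring G C f"
    and "f v1 = 1" "f v3 = 1" "f v2 = 2" "f v4 = 2"
    and "\<forall>i\<in>{3, 4}. bicoloured_paths (graph_of G) f 2 i v2 v4 \<noteq> {}"
    and "contractible_wheel G C f u u1 u2 u3 u2'"
    and "w \<notin> points G - {u2, u2'}"
    and "{u2, u2'} \<inter> points C \<subseteq> {w}"
    and "H = contract_wheel (graph_of G) u u2 u2' w"
    and "decyclizable H v2 v4"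
  shows "decyclizable (graph_of G) v2 v4"
proof (rule decyclizable_contract_wheelD)
  show "decyclizable (contract_wheel (graph_of G) u u2 u2' w) v2 v4"
    using assms by simp
  have "plane_graph G"
    using assms(1) by (simp add: four_base_module_def smpg_def semi_maximal_at_def)
  then show "{u} \<notin> edges (graph_of G)"
    by (rule plane_graph_no_loops)
  have wheel: "four_wheel G C u u1 u2 u3 u2'"
    using assms(9) by (simp add: contractible_wheel_def)
  then have "set [u1, u2, u3, u2'] = {x. {u, x} \<in> edges (graph_of G)}"
    unfolding four_wheel_def cyclic_neighbours_def by blast
  then show "{x. {u, x} \<in> edges (graph_of G)} \<subseteq> {u1, u2, u3, u2'}"
    by simp
  \<comment> \<open>The hub avoids \<open>points C\<close>, and only \<open>w\<close> can be both
    merged and on \<open>C\<close>, so both remaining side conditions follow.\<close>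
  have "{v2, v4} \<subseteq> points C"
    using assms(2) by (simp add: cycle_on_def)
  then show "u \<notin> {v2, v4}" "{u2, u2'} \<inter> {v2, v4} \<subseteq> {w}"
    using wheel assms(11) by (auto simp: four_wheel_def)
qed

end
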